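(* Let $(B,+,\circ)$ be a near brace. Then the triple $\mathrm{T}(B):=(B,[-,-,-],\circ)$, where $[a,b,c]:=a-b+c$ for all $a,b,c\in B$, is a near-truss such that $(B,\circ)$ is a group. Thus the triple $(B,+_1,\circ)$, where $a+_1b:=a-1+b$ for all $a,b\in B$, is a left skew brace. That is, the near brace $\mathrm{T}(B)$ and the left skew brace $(B,+_1,\circ)$ are isomorphic as near-trusses.
   Context: A near brace is a set $B$ with two group operations $+$ and $\circ$ (neither necessarily abelian) such that for all $a,b,c\in B$, $a\circ(b+c)=a\circ b-a\circ 0+a\circ c$, where $0$ is the neutral element of $(B,+)$ and $1$ is the neutral element of $(B,\circ)$. Here $\circ$ binds more tightly than $+,-$, and $-a$ is the inverse of $a$ in $(B,+)$. A left skew brace is a set $B$ with two group operations $+$ and $\circ$ such that $a\circ(b+c)=a\circ b-a+a\circ c$ for all $a,b,c\in B$. A near-truss is a set $T$ with a heap operation $[-,-,-]:T^3\to T$ (i.e. $[[a,b,c],d,e]=[a,b,[c,d,e]]$ and $[a,a,b]=b=[b,a,a]$) and an associative binary operation $\circ$ such that $a\circ[b,c,d]=[a\circ b,a\circ c,a\circ d]$ for all $a,b,c,d\in T$. A near-truss isomorphism is a bijection preserving the ternary and the binary operation. A left skew brace $(B,+_1,\circ)$ is regarded as a near-truss via $[a,b,c]=a-_1b+_1c$, where $-_1$ denotes subtraction in the group $(B,+_1)$. *)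

theory Defs
  imports "HOL-Algebra.Ring"
begin

text \<open>
  Sets with two group operations are represented by records of type \<open>'a ring\<close>: the field
  \<open>add\<close> with neutral element \<open>zero\<close> is \<open>+\<close>, and the field \<open>mult\<close> with neutral element \<open>one\<close>
  is \<open>\<circ>\<close>. Neither operation is assumed to be commutative, and no ring law is assumed.
  Subtraction \<open>\<ominus>\<close> is \<open>a \<ominus> b = a \<oplus> (\<ominus> b)\<close>, with the inverse of \<open>b\<close> in the additive group.
\<close>

locale near_brace =
  fixes B :: "('a, 'm) ring_scheme" (structure)
  assumes add_group: "group (add_monoid B)"
    and circ_group: "group B"
    and near_distrib:
      "\<lbrakk>a \<in> carrier B; b \<in> carrier B; c \<in> carrier B\<rbrakk> \<Longrightarrow>
        a \<otimes> (b \<oplus> c) = ((a \<otimes> b) \<ominus> (a \<otimes> \<zero>)) \<oplus> (a \<otimes> c)"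

locale left_skew_brace =
  fixes B :: "('a, 'm) ring_scheme" (structure)
  assumes add_group: "group (add_monoid B)"
    and circ_group: "group B"
    and skew_distrib:
      "\<lbrakk>a \<in> carrier B; b \<in> carrier B; c \<in> carrier B\<rbrakk> \<Longrightarrow>
        a \<otimes> (b \<oplus> c) = ((a \<otimes> b) \<ominus> a) \<oplus> (a \<otimes> c)"

record 'a truss = "'a partial_object" +
  heap :: "'a \<Rightarrow> 'a \<Rightarrow> 'a \<Rightarrow> 'a"
  circ :: "'a \<Rightarrow> 'a \<Rightarrow> 'a"

locale near_truss =
  fixes T :: "('a, 'm) truss_scheme"
  assumes heap_closed:
      "\<lbrakk>a \<in> carrier T; b \<in> carrier T; c \<in> carrier T\<rbrakk> \<Longrightarrow> heap T a b c \<in> carrier T"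
    and heap_assoc:
      "\<lbrakk>a \<in> carrier T; b \<in> carrier T; c \<in> carrier T; d \<in> carrier T; e \<in> carrier T\<rbrakk> \<Longrightarrow>
        heap T (heap T a b c) d e = heap T a b (heap T c d e)"
    and heap_left: "\<lbrakk>a \<in> carrier T; b \<in> carrier T\<rbrakk> \<Longrightarrow> heap T a a b = b"
    and heap_right: "\<lbrakk>a \<in> carrier T; b \<in> carrier T\<rbrakk> \<Longrightarrow> heap T b a a = b"
    and circ_closed: "\<lbrakk>a \<in> carrier T; b \<in> carrier T\<rbrakk> \<Longrightarrow> circ T a b \<in> carrier T"
    and circ_assoc:
      "\<lbrakk>a \<in> carrier T; b \<in> carrier T; c \<in> carrier T\<rbrakk> \<Longrightarrow>
        circ T (circ T a b) c = circ T a (circ T b c)"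
    and circ_heap:
      "\<lbrakk>a \<in> carrier T; b \<in> carrier T; c \<in> carrier T; d \<in> carrier T\<rbrakk> \<Longrightarrow>
        circ T a (heap T b c d) = heap T (circ T a b) (circ T a c) (circ T a d)"

definition near_truss_iso ::
    "('a, 'm) truss_scheme \<Rightarrow> ('b, 'n) truss_scheme \<Rightarrow> ('a \<Rightarrow> 'b) set" where
  "near_truss_iso S T = {f. bij_betw f (carrier S) (carrier T) \<and>
    (\<forall>a\<in>carrier S. \<forall>b\<in>carrier S. \<forall>c\<in>carrier S. f (heap S a b c) = heap T (f a) (f b) (f c)) \<and>
    (\<forall>a\<in>carrier S. \<forall>b\<in>carrier S. f (circ S a b) = circ T (f a) (f b))}"

definition isomorphic_near_trusses ::
    "('a, 'm) truss_scheme \<Rightarrow> ('b, 'n) truss_scheme \<Rightarrow> bool" where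
  "isomorphic_near_trusses S T \<longleftrightarrow>
    near_truss S \<and> near_truss T \<and> near_truss_iso S T \<noteq> {}"

text \<open>
  The triple \<open>(B, [-,-,-], \<circ>)\<close> with \<open>[a,b,c] = a - b + c\<close>. The same formula is used both for near
  braces and for regarding a left skew brace as a near-truss, \<open>\<ominus>\<close> and \<open>\<oplus>\<close> being those of the
  record it is applied to.
\<close>

definition truss_of :: "('a, 'm) ring_scheme \<Rightarrow> 'a truss" where
  "truss_of B = \<lparr>carrier = carrier B,
     heap = (\<lambda>a b c. (a \<ominus>\<^bsub>B\<^esub> b) \<oplus>\<^bsub>B\<^esub> c),
     circ = (\<lambda>a b. a \<otimes>\<^bsub>B\<^esub> b)\<rparr>"

text \<open>
  The triple \<open>(B, +\<^sub>1, \<circ>)\<close> with \<open>a +\<^sub>1 b = a - 1 + b\<close>. The neutral element of \<open>+\<^sub>1\<close>, which the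
  record has to name, is \<open>1\<close>.
\<close>

definition shifted_brace :: "('a, 'm) ring_scheme \<Rightarrow> 'a ring" where
  "shifted_brace B = \<lparr>carrier = carrier B,
     mult = (\<lambda>a b. a \<otimes>\<^bsub>B\<^esub> b), one = \<one>\<^bsub>B\<^esub>,
     zero = \<one>\<^bsub>B\<^esub>, add = (\<lambda>a b. (a \<ominus>\<^bsub>B\<^esub> \<one>\<^bsub>B\<^esub>) \<oplus>\<^bsub>B\<^esub> b)\<rparr>"

end

theory Submission
  imports Defs
begin

text \<open>
  Cancelling in \<open>a \<circ> b = a \<circ> ((b - c) + c) = a \<circ> (b - c) - a \<circ> 0 + a \<circ> c\<close> shows that left
  multiplication respects the heap operation. The heap of a group recovers the group up to the
  choice of the neutral element, so recentring at \<open>1\<close> leaves the heap unchanged, and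
  \<open>a \<circ> (b - 1 + c) = a \<circ> b - a + a \<circ> c\<close> is the skew brace law.
\<close>

context group
begin

text \<open>For \<open>e\<close> in the carrier this is the retract at \<open>e\<close> of the heap
  of \<open>G\<close>; right multiplication by \<open>e\<close> maps \<open>G\<close> isomorphically
  onto it.\<close>

definition translate :: "'a \<Rightarrow> 'a monoid" where
  "translate e = \<lparr>carrier = carrier G, mult = (\<lambda>a b. a \<otimes> inv e \<otimes> b), one = e\<rparr>"

text \<open>Once \<open>m_assoc\<close> has nested a product to the right, these rules cancel
  mutually inverse neighbours in its interior, so that \<open>simp\<close> settles the word
  identities below.\<close>

lemma inv_mult_cancel_left [simp]:
  assumes "a \<in> carrier G" "b \<in> carrier G"
  shows "inv a \<otimes> (a \<otimes> b) = b" "a \<otimes> (inv a \<otimes> b) = b"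
  using assms by (simp_all add: m_assoc [symmetric])

lemma group_translate:
  assumes "e \<in> carrier G"
  shows "group (translate e)"
proof (rule groupI)
  fix a assume "a \<in> carrier (translate e)"
  then show "\<exists>b\<in>carrier (translate e). b \<otimes>\<^bsub>translate e\<^esub> a = \<one>\<^bsub>translate e\<^esub>"
    using assms
    \<comment> \<open>The witness solves \<open>x \<otimes> inv e \<otimes> a = e\<close> for
      \<open>x\<close>.\<close>
    by (intro bexI [of _ "e \<otimes> inv a \<otimes> e"]) (simp_all add: translate_def m_assoc)
qed (use assms in \<open>simp_all add: translate_def m_assoc\<close>)

lemma inv_translate:
  assumes "e \<in> carrier G" "a \<in> carrier G"
  shows "inv\<^bsub>translate e\<^esub> a = e \<otimes> inv a \<otimes> e"
proof -
  interpret T: group "translate e"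
    using assms(1) by (rule group_translate)
  show ?thesis
    using assms by (intro T.inv_equality) (simp_all add: translate_def m_assoc)
qed

text \<open>The left side is \<open>a \<otimes> inv e \<otimes> (e \<otimes> inv b \<otimes> e)
  \<otimes> inv e \<otimes> c\<close>, and both pairs of \<open>e\<close> and \<open>inv e\<close>
  cancel.\<close>

lemma heap_translate:
  assumes "e \<in> carrier G" "a \<in> carrier G" "b \<in> carrier G" "c \<in> carrier G"
  shows "a \<otimes>\<^bsub>translate e\<^esub> inv\<^bsub>translate e\<^esub> b \<otimes>\<^bsub>translate e\<^esub> c = a \<otimes> inv b \<otimes> c"
  using assms by (simp add: inv_translate) (simp add: translate_def m_assoc)

end

context near_brace
begin

sublocale add: group "add_monoid B"
  rewrites "carrier (add_monoid B) = carrier B"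
    and "mult (add_monoid B) = add B"
    and "one (add_monoid B) = zero B"
    and "m_inv (add_monoid B) = a_inv B"
  by (rule add_group) (simp_all add: a_inv_def)

sublocale circ: group B
  by (rule circ_group)

lemma minus_closed [simp, intro]:
  "\<lbrakk>a \<in> carrier B; b \<in> carrier B\<rbrakk> \<Longrightarrow> a \<ominus> b \<in> carrier B"
  by (simp add: a_minus_def)

lemma circ_minus:
  assumes "a \<in> carrier B" "b \<in> carrier B" "c \<in> carrier B"
  shows "a \<otimes> (b \<ominus> c) = (a \<otimes> b) \<ominus> (a \<otimes> c) \<oplus> a \<otimes> \<zero>"
proof -
  have "a \<otimes> b = a \<otimes> ((b \<ominus> c) \<oplus> c)"
    using assms by (simp add: a_minus_def add.m_assoc)
  also have "\<dots> = a \<otimes> (b \<ominus> c) \<ominus> a \<otimes> \<zero> \<oplus> a \<otimes> c"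
    using assms by (simp add: near_distrib)
  \<comment> \<open>Substituting for \<open>a \<otimes> b\<close> in the goal puts
    \<open>a \<otimes> c\<close> next to its negative; after that \<open>a \<otimes> \<zero>\<close>
    meets its negative too.\<close>
  finally show ?thesis
    using assms by (simp add: a_minus_def add.m_assoc)
qed

text \<open>The terms \<open>a \<otimes> \<zero>\<close> coming from \<open>circ_minus\<close> and
  from \<open>near_distrib\<close> are adjacent with opposite signs.\<close>

lemma circ_heap:
  assumes "a \<in> carrier B" "b \<in> carrier B" "c \<in> carrier B" "d \<in> carrier B"
  shows "a \<otimes> (b \<ominus> c \<oplus> d) = (a \<otimes> b) \<ominus> (a \<otimes> c) \<oplus> a \<otimes> d"
  using assms by (simp add: near_distrib circ_minus) (simp add: a_minus_def add.m_assoc)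

lemma near_truss_truss_of: "near_truss (truss_of B)"
  by unfold_locales
    (simp_all add: truss_of_def circ.m_assoc circ_heap, simp_all add: a_minus_def add.m_assoc)

text \<open>This makes the facts on \<open>translate\<close> available for the additive group of the
  shifted brace.\<close>

lemma add_monoid_shifted_brace: "add_monoid (shifted_brace B) = add.translate \<one>"
  by (simp add: shifted_brace_def add.translate_def a_minus_def)

lemma heap_shifted_brace:
  assumes "a \<in> carrier B" "b \<in> carrier B" "c \<in> carrier B"
  shows "(a \<ominus>\<^bsub>shifted_brace B\<^esub> b) \<oplus>\<^bsub>shifted_brace B\<^esub> c = a \<ominus> b \<oplus> c"
proof -
  have add_eq: "add (shifted_brace B) = mult (add.translate \<one>)"
    by (simp flip: add_monoid_shifted_brace)
  have "a_inv (shifted_brace B) = m_inv (add.translate \<one>)"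
    unfolding a_inv_def add_monoid_shifted_brace ..
  then show ?thesis
    using add.heap_translate [of \<one> a b c] assms by (simp add: a_minus_def add_eq)
qed

lemma left_skew_brace_shifted_brace: "left_skew_brace (shifted_brace B)"
proof (rule left_skew_brace.intro)
  show "group (add_monoid (shifted_brace B))"
    unfolding add_monoid_shifted_brace by (rule add.group_translate) simp
  show "group (shifted_brace B)"
    by (rule groupI) (auto simp: shifted_brace_def circ.m_assoc intro: circ.l_inv_ex)
next
  fix a b c
  assume "a \<in> carrier (shifted_brace B)" "b \<in> carrier (shifted_brace B)"
    "c \<in> carrier (shifted_brace B)"
  then have abc: "a \<in> carrier B" "b \<in> carrier B" "c \<in> carrier B"
    by (simp_all add: shifted_brace_def)
  \<comment> \<open>The middle term \<open>a \<otimes> \<one>\<close> is \<open>a\<close>, the one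
    subtracted in the skew brace law.\<close>
  have "a \<otimes> (b \<ominus> \<one> \<oplus> c) = (a \<otimes> b) \<ominus> a \<oplus> a \<otimes> c"
    using abc by (simp add: circ_heap)
  \<comment> \<open>The right side is a heap value, so it may be read in the shifted group.\<close>
  also have "\<dots> = (a \<otimes> b \<ominus>\<^bsub>shifted_brace B\<^esub> a) \<oplus>\<^bsub>shifted_brace B\<^esub> a \<otimes> c"
    using abc by (simp add: heap_shifted_brace)
  finally show "a \<otimes>\<^bsub>shifted_brace B\<^esub> (b \<oplus>\<^bsub>shifted_brace B\<^esub> c) =
      (a \<otimes>\<^bsub>shifted_brace B\<^esub> b \<ominus>\<^bsub>shifted_brace B\<^esub> a)
        \<oplus>\<^bsub>shifted_brace B\<^esub> (a \<otimes>\<^bsub>shifted_brace B\<^esub> c)"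
    by (simp add: shifted_brace_def)
qed

lemma isomorphic_near_trusses_shifted_brace:
  "isomorphic_near_trusses (truss_of B) (truss_of (shifted_brace B))"
proof -
  have carr: "carrier (truss_of (shifted_brace B)) = carrier B"
    and circ: "circ (truss_of (shifted_brace B)) a b = a \<otimes> b" for a b
    by (simp_all add: truss_of_def shifted_brace_def)
  \<comment> \<open>The heaps are compared on the carrier only, so the near-truss axioms are checked
    again instead of being carried over by an equality of records.\<close>
  have heap: "heap (truss_of (shifted_brace B)) a b c = a \<ominus> b \<oplus> c"
    if "a \<in> carrier B" "b \<in> carrier B" "c \<in> carrier B" for a b c
    using that by (simp add: truss_of_def heap_shifted_brace)
  have "near_truss (truss_of (shifted_brace B))"
    by unfold_locales
      (simp_all add: carr circ heap circ.m_assoc circ_heap,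
        simp_all add: a_minus_def add.m_assoc)
  \<comment> \<open>Carriers and operations agree, so the identity serves as isomorphism.\<close>
  moreover have "id \<in> near_truss_iso (truss_of B) (truss_of (shifted_brace B))"
    by (simp add: near_truss_iso_def truss_of_def [of B] carr circ heap)
  ultimately show ?thesis
    using near_truss_truss_of by (auto simp: isomorphic_near_trusses_def)
qed

end

theorem corollary2p15:
  fixes B :: "('a, 'm) ring_scheme"
  assumes "near_brace B"
  shows "near_truss (truss_of B)
    \<and> group \<lparr>carrier = carrier (truss_of B), mult = circ (truss_of B), one = \<one>\<^bsub>B\<^esub>\<rparr>
    \<and> left_skew_brace (shifted_brace B)
    \<and> isomorphic_near_trusses (truss_of B) (truss_of (shifted_brace B))"
proof -
  interpret near_brace B
    by (rule assms)
  have "group \<lparr>carrier = carrier (truss_of B), mult = circ (truss_of B), one = \<one>\<^bsub>B\<^esub>\<rparr>"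
    by (rule groupI) (auto simp: truss_of_def circ.m_assoc intro: circ.l_inv_ex)
  then show ?thesis
    using near_truss_truss_of left_skew_brace_shifted_brace
      isomorphic_near_trusses_shifted_brace by blast
qed

end
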